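(* Let $f,g\in C^2[0,1]$, with $g$ monotonically increasing, $g'(x)\neq0$ for $x\in[0,1]$ and $g''(x)\ne0$ for $x\in(0,1)$, and let $\sigma:=\max_{x\in[0,1]}|g'(x)|$. Let $\kappa>1$, let $n\in\mathbb{N}$ with $n>1$, and let $\eta:=\max\{1/\kappa,\,1-\kappa^{-1/(n-1)}\}$. If $\Psi:=(f/g')\circ g^{-1}\in C^{m+1}[g(0),g(1)]$ for some $m\in\mathbb{N}$, then $$\left|\mathcal{I}_\kappa[f,g]-\mathcal{Q}_{\kappa,n,m}[f,g]\right|\le\frac{3(m+1)}{m!\,\kappa^2}\,\|\Psi^{(m+1)}\|_\infty\,\sigma\,\eta^{m-1},$$ and $\mathcal{N}\big(\mathcal{Q}_{\kappa,n,m}[f,g]\big)\le\lceil\sigma\rceil nm+1$.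
   Context: $\mathbb{N}=\{1,2,\dots\}$; $\|\cdot\|_\infty$ is the maximum norm; $\mathcal{I}_\kappa[f,g]:=\int_0^1 f(x)e^{\mathrm{i}\kappa g(x)}\,dx$. Basic Filon-type rule. For $[a,b]\subset[0,1]$ and $m\in\mathbb{N}$, choose (arbitrary) nodes $a=t_0<t_1<\dots<t_m=b$ and let $p_m$ be the polynomial of degree at most $m$ with $p_m(g(t_j))=\Psi(g(t_j))$, $j=0,\dots,m$. Put $\mathcal{Q}^{[a,b]}_{\kappa,m}[f,g]:=\int_{g(a)}^{g(b)}p_m(x)e^{\mathrm{i}\kappa x}\,dx$. For $N\in\mathbb{N}$ let $y_j:=a+(b-a)j/N$, $j=0,\dots,N$, and $\mathcal{Q}^{[a,b]}_{N,\kappa,m}[f,g]:=\sum_{j=1}^{N}\mathcal{Q}^{[y_{j-1},y_j]}_{\kappa,m}[f,g]$. Partition: $x_0=0$, $x_j=\kappa^{(j-1)/(n-1)-1}$ for $j=1,\dots,n$. Put $M_j:=\max\{|g'(x_{j-1})|,|g'(x_j)|\}$ and $N_j:=\lceil M_j\rceil$ for $j=1,\dots,n$. Composite rule: $\mathcal{Q}_{\kappa,n,m}[f,g]:=\sum_{j=1}^{n}\mathcal{Q}^{[x_{j-1},x_j]}_{N_j,\kappa,m}[f,g]$. $\mathcal{N}(F)$ denotes the number of evaluations of $\Psi$ used in the quadrature formula $F$ (an evaluation at an endpoint shared by two subintervals is counted once). *)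

theory Defs
  imports "HOL-Analysis.Analysis" "HOL-Computational_Algebra.Polynomial"
begin

(* Derivatives at the endpoints of a closed interval S are one-sided,
   hence the use of "at x within S". *)

primrec deriv_within :: "real set \<Rightarrow> nat \<Rightarrow> (real \<Rightarrow> 'a::real_normed_vector) \<Rightarrow> real \<Rightarrow> 'a" where
  "deriv_within S 0 f = f"
| "deriv_within S (Suc k) f = (\<lambda>x. vector_derivative (deriv_within S k f) (at x within S))"

definition C_on :: "nat \<Rightarrow> real set \<Rightarrow> (real \<Rightarrow> 'a::real_normed_vector) \<Rightarrow> bool" where
  "C_on k S f \<longleftrightarrow>
     (\<forall>j<k. \<forall>x\<in>S. deriv_within S j f differentiable (at x within S)) \<and>
     continuous_on S (deriv_within S k f)"

definition sup_norm_on :: "real set \<Rightarrow> (real \<Rightarrow> 'a::real_normed_vector) \<Rightarrow> real" where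
  "sup_norm_on S f = (SUP x\<in>S. norm (f x))"

definition osc_integral :: "real \<Rightarrow> (real \<Rightarrow> complex) \<Rightarrow> (real \<Rightarrow> real) \<Rightarrow> complex" where
  "osc_integral \<kappa> f g = integral {0..1} (\<lambda>x. f x * exp (\<i> * complex_of_real (\<kappa> * g x)))"

definition Psi :: "(real \<Rightarrow> complex) \<Rightarrow> (real \<Rightarrow> real) \<Rightarrow> real \<Rightarrow> complex" where
  "Psi f g = (\<lambda>x. f x / complex_of_real (deriv_within {0..1} 1 g x)) \<circ> inv_into {0..1} g"

(* A choice of nodes: T a b 0, ..., T a b m are the nodes used on [a,b]. *)

definition valid_nodes :: "nat \<Rightarrow> (real \<Rightarrow> real \<Rightarrow> nat \<Rightarrow> real) \<Rightarrow> bool" where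
  "valid_nodes m T \<longleftrightarrow>
     (\<forall>a b. 0 \<le> a \<and> a < b \<and> b \<le> 1 \<longrightarrow>
        T a b 0 = a \<and> T a b m = b \<and> (\<forall>j<m. T a b j < T a b (Suc j)))"

definition interp_poly :: "nat \<Rightarrow> (nat \<Rightarrow> real) \<Rightarrow> (real \<Rightarrow> complex) \<Rightarrow> complex poly" where
  "interp_poly m s F =
     (THE p. degree p \<le> m \<and> (\<forall>j\<le>m. poly p (complex_of_real (s j)) = F (s j)))"

definition filon ::
  "(real \<Rightarrow> real \<Rightarrow> nat \<Rightarrow> real) \<Rightarrow> real \<Rightarrow> nat \<Rightarrow> (real \<Rightarrow> complex) \<Rightarrow> (real \<Rightarrow> real) \<Rightarrow> real \<Rightarrow> real \<Rightarrow> complex" where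
  "filon T \<kappa> m f g a b =
     integral {g a..g b} (\<lambda>x. poly (interp_poly m (\<lambda>j. g (T a b j)) (Psi f g)) (complex_of_real x)
                                * exp (\<i> * complex_of_real (\<kappa> * x)))"

definition uniform_pt :: "nat \<Rightarrow> real \<Rightarrow> real \<Rightarrow> nat \<Rightarrow> real" where
  "uniform_pt N a b j = a + (b - a) * real j / real N"

definition filon_uniform ::
  "(real \<Rightarrow> real \<Rightarrow> nat \<Rightarrow> real) \<Rightarrow> nat \<Rightarrow> real \<Rightarrow> nat \<Rightarrow> (real \<Rightarrow> complex) \<Rightarrow> (real \<Rightarrow> real) \<Rightarrow> real \<Rightarrow> real \<Rightarrow> complex" where
  "filon_uniform T N \<kappa> m f g a b =
     (\<Sum>j=1..N. filon T \<kappa> m f g (uniform_pt N a b (j - 1)) (uniform_pt N a b j))"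

definition graded_pt :: "real \<Rightarrow> nat \<Rightarrow> nat \<Rightarrow> real" where
  "graded_pt \<kappa> n j =
     (if j = 0 then 0 else \<kappa> powr ((real j - 1) / (real n - 1) - 1))"

definition subdiv :: "real \<Rightarrow> nat \<Rightarrow> (real \<Rightarrow> real) \<Rightarrow> nat \<Rightarrow> nat" where
  "subdiv \<kappa> n g j =
     nat \<lceil>max \<bar>deriv_within {0..1} 1 g (graded_pt \<kappa> n (j - 1))\<bar>
               \<bar>deriv_within {0..1} 1 g (graded_pt \<kappa> n j)\<bar>\<rceil>"

definition filon_composite ::
  "(real \<Rightarrow> real \<Rightarrow> nat \<Rightarrow> real) \<Rightarrow> real \<Rightarrow> nat \<Rightarrow> nat \<Rightarrow> (real \<Rightarrow> complex) \<Rightarrow> (real \<Rightarrow> real) \<Rightarrow> complex" where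
  "filon_composite T \<kappa> n m f g =
     (\<Sum>j=1..n. filon_uniform T (subdiv \<kappa> n g j) \<kappa> m f g (graded_pt \<kappa> n (j - 1)) (graded_pt \<kappa> n j))"

(* The points at which Psi f g is evaluated by the three rules above. As these
   are sets, a point shared by adjacent subintervals is counted only once. *)

definition filon_eval_pts ::
  "(real \<Rightarrow> real \<Rightarrow> nat \<Rightarrow> real) \<Rightarrow> nat \<Rightarrow> (real \<Rightarrow> real) \<Rightarrow> real \<Rightarrow> real \<Rightarrow> real set" where
  "filon_eval_pts T m g a b = (\<lambda>k. g (T a b k)) ` {0..m}"

definition filon_uniform_eval_pts ::
  "(real \<Rightarrow> real \<Rightarrow> nat \<Rightarrow> real) \<Rightarrow> nat \<Rightarrow> nat \<Rightarrow> (real \<Rightarrow> real) \<Rightarrow> real \<Rightarrow> real \<Rightarrow> real set" where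
  "filon_uniform_eval_pts T N m g a b =
     (\<Union>j\<in>{1..N}. filon_eval_pts T m g (uniform_pt N a b (j - 1)) (uniform_pt N a b j))"

definition filon_composite_eval_pts ::
  "(real \<Rightarrow> real \<Rightarrow> nat \<Rightarrow> real) \<Rightarrow> real \<Rightarrow> nat \<Rightarrow> nat \<Rightarrow> (real \<Rightarrow> real) \<Rightarrow> real set" where
  "filon_composite_eval_pts T \<kappa> n m g =
     (\<Union>j\<in>{1..n}. filon_uniform_eval_pts T (subdiv \<kappa> n g j) m g
                    (graded_pt \<kappa> n (j - 1)) (graded_pt \<kappa> n j))"

definition num_evals ::
  "(real \<Rightarrow> real \<Rightarrow> nat \<Rightarrow> real) \<Rightarrow> real \<Rightarrow> nat \<Rightarrow> nat \<Rightarrow> (real \<Rightarrow> real) \<Rightarrow> nat" where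
  "num_evals T \<kappa> n m g = card (filon_composite_eval_pts T \<kappa> n m g)"

end

theory Submission
  imports Defs
begin

text \<open>
  The substitution \<open>y = g x\<close> turns the oscillatory integral into the Fourier integral of
  \<open>\<Psi>\<close> over \<open>[g 0, g 1]\<close>. On one panel of length \<open>h\<close> in the variable \<open>y\<close> the interpolation
  error \<open>E = \<Psi> - p\<close> vanishes at both ends, so two integrations by parts bound the quadrature
  error by \<open>(2 max |E'| + h max |E''|) / \<kappa>\<^sup>2\<close>. Since \<open>E'\<close> and \<open>E''\<close> are (by Rolle) again
  interpolation errors with \<open>m\<close> and \<open>m - 1\<close> zeros, this is at most
  \<open>(m + 2) h ^ m / (m! \<kappa>\<^sup>2)\<close> times the norm of the \<open>(m + 1)\<close>-st derivative of \<open>\<Psi>\<close>.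
  The derivative of \<open>g\<close> is monotone, hence bounded by \<open>N j\<close> on the \<open>j\<close>-th subinterval, so
  every panel has \<open>h \<le> \<eta>\<close>; as the lengths add up to \<open>g 1 - g 0 \<le> \<sigma>\<close>, the sum of all \<open>h ^ m\<close>
  is at most \<open>\<sigma> \<eta> ^ (m - 1)\<close>.
\<close>

section \<open>Zeros of derivatives and the interpolation error\<close>

text \<open>Rolle's theorem is applied between neighbours in the sorted list of zeros. The open gaps
  are disjoint, so the \<open>s\<close> zeros obtained are distinct.\<close>

lemma derivative_zeros:
  fixes F F' :: "real \<Rightarrow> real"
  assumes F: "\<And>x. x \<in> {A..B} \<Longrightarrow> (F has_real_derivative F' x) (at x within {A..B})"
    and Z: "finite Z" "Z \<subseteq> {A..B}" "card Z = Suc s" "\<And>z. z \<in> Z \<Longrightarrow> F z = 0"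
  obtains W where "finite W" "W \<subseteq> {A..B}" "card W = s" "\<And>w. w \<in> W \<Longrightarrow> F' w = 0"
proof -
  define l where "l = sorted_list_of_set Z"
  have len: "length l = Suc s" and set_l: "set l = Z"
    using Z by (auto simp: l_def)
  have less: "l ! i < l ! j" if "i < j" "j < Suc s" for i j
    using that len strict_sorted_list_of_set[of Z] sorted_wrt_nth_less[of "(<)" l i j]
    by (auto simp: l_def)
  have mem: "l ! i \<in> Z" if "i < Suc s" for i
    using that len set_l nth_mem[of i l] by auto
  have "\<exists>w. l ! i < w \<and> w < l ! Suc i \<and> F' w = 0" if i: "i < s" for i
  proof -
    have sub: "{l ! i..l ! Suc i} \<subseteq> {A..B}"
      using mem[of i] mem[of "Suc i"] i Z(2) by auto
    have cont: "continuous_on {l ! i..l ! Suc i} F"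
      using continuous_on_subset[OF DERIV_continuous_on[OF F] sub] by blast
    have "\<exists>w>l ! i. w < l ! Suc i \<and> F' w = 0"
    proof -
      have "\<exists>z. l ! i < z \<and> z < l ! Suc i \<and> (\<lambda>v. F' z * v) = (\<lambda>v. 0)"
      proof (rule Rolle_deriv)
        show "l ! i < l ! Suc i" using less i by auto
        show "F (l ! i) = F (l ! Suc i)" using mem[of i] mem[of "Suc i"] i Z(4) by auto
        fix x assume x: "l ! i < x" "x < l ! Suc i"
        then have "A < x" "x < B" 
          using mem[of i] mem[of "Suc i"] i Z(2) by force+
        then have "(F has_real_derivative F' x) (at x)"
          using F[of x] at_within_Icc_at[of A x B] by auto
        then show "(F has_derivative (\<lambda>v. F' x * v)) (at x)"
          by (simp add: has_field_derivative_def)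
      qed (rule cont)
      \<comment> \<open>\<open>Rolle_deriv\<close> makes the derivative vanish as a linear map;
        evaluating that map at 1 gives \<open>F' z\<close>.\<close>
      then show ?thesis by (metis mult.right_neutral)
    qed
    then show ?thesis by blast
  qed
  then obtain w where w: "\<And>i. i < s \<Longrightarrow> l ! i < w i \<and> w i < l ! Suc i \<and> F' (w i) = 0"
    by metis
  have w_less: "w i < w j" if "i < j" "j < s" for i j
  proof -
    have "l ! Suc i \<le> l ! j"
      using that less[of "Suc i" j] by (cases "Suc i = j") auto
    then show ?thesis using w[of i] w[of j] that by force
  qed
  have "inj_on w {..<s}"
    by (rule linorder_inj_onI) (use w_less in \<open>auto dest: less_imp_neq\<close>)
  then have "card (w ` {..<s}) = s" by (simp add: card_image)
  moreover have "w i \<in> {A..B}" if "i < s" for i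
    using w[OF that] mem[of i] mem[of "Suc i"] that Z(2) by force
  ultimately show thesis
    using w by (intro that[of "w ` {..<s}"]) auto
qed

text \<open>Each differentiation costs one zero, by repeated use of Rolle's theorem.\<close>

lemma higher_derivative_zeros:
  fixes D :: "nat \<Rightarrow> real \<Rightarrow> real"
  assumes "\<And>k x. k < r \<Longrightarrow> x \<in> {A..B} \<Longrightarrow> (D k has_real_derivative D (Suc k) x) (at x within {A..B})"
    and "finite Z" "Z \<subseteq> {A..B}" "card Z = q + r" "\<And>z. z \<in> Z \<Longrightarrow> D 0 z = 0"
  obtains W where "finite W" "W \<subseteq> {A..B}" "card W = q" "\<And>w. w \<in> W \<Longrightarrow> D r w = 0"
  using assms
proof (induction r arbitrary: q thesis)
  case 0
  then show ?case by auto
next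
  case (Suc r)
  obtain W where W: "finite W" "W \<subseteq> {A..B}" "card W = Suc q" "\<And>w. w \<in> W \<Longrightarrow> D r w = 0"
    by (rule Suc.IH[of "Suc q"]) (use Suc.prems in auto)
  obtain V where "finite V" "V \<subseteq> {A..B}" "card V = q" "\<And>w. w \<in> V \<Longrightarrow> D (Suc r) w = 0"
    using derivative_zeros[of A B "D r" "D (Suc r)" W q] Suc.prems(2)[of r] W by blast
  then show ?case by (rule Suc.prems(1))
qed

text \<open>The lower terms die and the leading term contributes \<open>fact q\<close>. This
  evaluates the top derivative of the node polynomial.\<close>

lemma higher_pderiv_monic:
  fixes p :: "'a::{idom,ring_char_0} poly"
  assumes "degree p = q" "lead_coeff p = 1"
  shows "(pderiv ^^ q) p = [:fact q:]"
proof (rule poly_eqI)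
  fix n show "coeff ((pderiv ^^ q) p) n = coeff [:fact q:] n"
    using assms by (cases n) (auto simp: coeff_higher_pderiv coeff_eq_0 pochhammer_fact coeff_pCons)
qed

text \<open>This is Cauchy's remainder formula for the interpolant 0: with the node polynomial
  \<omega>, \<open>D 0 x\<close> equals \<open>D q \<xi> * poly \<omega> x / fact q\<close> for some
  \<xi>, and every factor of \<open>poly \<omega> x\<close> is at most \<open>B - A\<close> in
  absolute value. Passing the derivatives as a family lets the bound be used for shifted families
  too.\<close>

lemma bound_from_zeros:
  fixes D :: "nat \<Rightarrow> real \<Rightarrow> real"
  assumes D: "\<And>k x. k < q \<Longrightarrow> x \<in> {A..B} \<Longrightarrow> (D k has_real_derivative D (Suc k) x) (at x within {A..B})"
    and Z: "finite Z" "Z \<subseteq> {A..B}" "card Z = q" "\<And>z. z \<in> Z \<Longrightarrow> D 0 z = 0"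
    and bound: "\<And>x. x \<in> {A..B} \<Longrightarrow> \<bar>D q x\<bar> \<le> C"
    and x: "x \<in> {A..B}"
  shows "\<bar>D 0 x\<bar> \<le> C * (B - A) ^ q / fact q"
proof (cases "x \<in> Z")
  case True
  have "0 \<le> C" using bound[OF x] by linarith
  then show ?thesis using True Z(4) x by auto
next
  case False
  define \<omega> :: "real poly" where "\<omega> = (\<Prod>z\<in>Z. [:- z, 1:])"
  have deg: "degree \<omega> = q"
    using Z by (simp add: \<omega>_def degree_prod_eq_sum_degree)
  have "lead_coeff \<omega> = 1"
    by (simp add: \<omega>_def lead_coeff_prod)
  with deg have pd: "(pderiv ^^ q) \<omega> = [:fact q:]" by (rule higher_pderiv_monic)
  have \<omega>_eq: "poly \<omega> t = (\<Prod>z\<in>Z. t - z)" for t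
    by (simp add: \<omega>_def poly_prod)
  have \<omega>x: "poly \<omega> x \<noteq> 0" using False Z(1) by (auto simp: \<omega>_eq)
  \<comment> \<open>\<open>K\<close> makes \<open>D 0 - K * \<omega>\<close> vanish at \<open>x\<close> as well as on \<open>Z\<close>.\<close>
  define K where "K = D 0 x / poly \<omega> x"
  define H where "H k t = D k t - K * poly ((pderiv ^^ k) \<omega>) t" for k t
  obtain W where W: "finite W" "W \<subseteq> {A..B}" "card W = 1" "\<And>w. w \<in> W \<Longrightarrow> H q w = 0"
  proof (rule higher_derivative_zeros[of q A B H "insert x Z" 1])
    show "(H k has_real_derivative H (Suc k) t) (at t within {A..B})"
      if "k < q" "t \<in> {A..B}" for k t
      unfolding H_def
      by (auto intro!: derivative_eq_intros D[OF that] DERIV_subset[OF poly_DERIV])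
    show "H 0 z = 0" if "z \<in> insert x Z" for z
      using that \<omega>x Z(1,4) by (auto simp: H_def K_def \<omega>_eq)
  qed (use Z x False in auto)
  then obtain \<xi> where \<xi>: "\<xi> \<in> {A..B}" "H q \<xi> = 0" by (auto simp: card_1_singleton_iff)
  then have "D q \<xi> = K * fact q" by (simp add: H_def pd)
  then have "D 0 x = D q \<xi> * poly \<omega> x / fact q" using \<omega>x by (simp add: K_def field_simps)
  then have "\<bar>D 0 x\<bar> = \<bar>D q \<xi>\<bar> * \<bar>poly \<omega> x\<bar> / fact q" by (simp add: abs_mult)
  also have "\<bar>poly \<omega> x\<bar> \<le> (B - A) ^ q"
  proof -
    have "(\<Prod>z\<in>Z. \<bar>x - z\<bar>) \<le> (\<Prod>z\<in>Z. B - A)"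
      using Z(2) x by (intro prod_mono) (auto simp: abs_if)
    then show ?thesis using Z(3) by (simp add: \<omega>_eq abs_prod)
  qed
  then have "\<bar>D q \<xi>\<bar> * \<bar>poly \<omega> x\<bar> / fact q \<le> C * (B - A) ^ q / fact q"
    using bound[OF \<xi>(1)] by (intro divide_right_mono mult_mono) auto
  finally show ?thesis .
qed

lemma higher_pderiv_has_vector_derivative:
  fixes p :: "complex poly"
  shows "((\<lambda>t. poly ((pderiv ^^ j) p) (of_real t)) has_vector_derivative
           poly ((pderiv ^^ Suc j) p) (of_real t)) (at t within S)"
  by (rule has_vector_derivative_real_field) (simp add: poly_DERIV)

text \<open>The error has m + 1 zeros, so its k-th derivative keeps \<open>Suc m - k\<close> of
  them, and \<open>bound_from_zeros\<close> applies to that derivative. Since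
  \<open>degree p \<le> m\<close>, the derivative of order m + 1 of the error is
  \<open>D (Suc m)\<close> alone.\<close>

lemma interpolation_error_derivative:
  fixes D :: "nat \<Rightarrow> real \<Rightarrow> complex" and p :: "complex poly"
  assumes D: "\<And>k x. k \<le> m \<Longrightarrow> x \<in> {A..B} \<Longrightarrow>
      (D k has_vector_derivative D (Suc k) x) (at x within {A..B})"
    and bound: "\<And>x. x \<in> {A..B} \<Longrightarrow> cmod (D (Suc m) x) \<le> C"
    and p: "degree p \<le> m"
    and Z: "finite Z" "Z \<subseteq> {A..B}" "card Z = Suc m" "\<And>z. z \<in> Z \<Longrightarrow> poly p (of_real z) = D 0 z"
    and k: "k \<le> Suc m" and x: "x \<in> {A..B}"
  shows "cmod (D k x - poly ((pderiv ^^ k) p) (of_real x))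
           \<le> C * (B - A) ^ (Suc m - k) / fact (Suc m - k)"
proof -
  define E where "E j t = D j t - poly ((pderiv ^^ j) p) (of_real t)" for j t
  \<comment> \<open>Rolle's theorem fails for complex values, so rotate the error at the given point onto the
    positive real axis and take real parts.\<close>
  define u where "u = cnj (E k x) / cmod (E k x)"
  \<comment> \<open>If \<open>E k x = 0\<close>, division by zero gives \<open>u = 0\<close>, so
    only an inequality holds; it suffices for the upper bound.\<close>
  have u: "cmod u \<le> 1" by (simp add: u_def norm_divide)
  have uE: "Re (u * E k x) = cmod (E k x)"
    by (cases "E k x = 0") (auto simp: u_def complex_norm_square[symmetric] power2_eq_square mult.commute)
  define R where "R j t = Re (u * E j t)" for j t
  have R: "(R j has_real_derivative R (Suc j) t) (at t within {A..B})"
    if "j \<le> m" "t \<in> {A..B}" for j t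
  proof -
    from has_vector_derivative_diff[OF D[OF that] higher_pderiv_has_vector_derivative]
    have "(E j has_vector_derivative E (Suc j) t) (at t within {A..B})"
      unfolding E_def .
    from bounded_linear.has_vector_derivative[OF bounded_linear_Re
      bounded_linear.has_vector_derivative[OF bounded_linear_mult_right this]]
    show ?thesis
      unfolding R_def has_real_derivative_iff_has_vector_derivative .
  qed
  obtain W where W: "finite W" "W \<subseteq> {A..B}" "card W = Suc m - k" "\<And>w. w \<in> W \<Longrightarrow> R k w = 0"
    by (rule higher_derivative_zeros[of k A B R Z "Suc m - k"]) 
      (use R Z k in \<open>auto simp: R_def E_def\<close>)
  \<comment> \<open>The index is written \<open>0 + k\<close> to match \<open>D 0\<close> of the
    shifted family \<open>\<lambda>j. R (j + k)\<close>.\<close>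
  have "\<bar>R (0 + k) x\<bar> \<le> C * (B - A) ^ (Suc m - k) / fact (Suc m - k)"
  proof (rule bound_from_zeros[of _ A B "\<lambda>j. R (j + k)" W])
    fix t assume t: "t \<in> {A..B}"
    have "(pderiv ^^ Suc m) p = 0"
      using p by (intro poly_eqI) (simp add: coeff_higher_pderiv coeff_eq_0 del: funpow.simps)
    then have E: "E (Suc m) t = D (Suc m) t" by (simp add: E_def)
    have "\<bar>R (Suc m) t\<bar> \<le> cmod (u * E (Suc m) t)"
      unfolding R_def by (rule abs_Re_le_cmod)
    also have "\<dots> \<le> 1 * cmod (D (Suc m) t)"
      unfolding norm_mult E using u by (intro mult_right_mono) auto
    also have "\<dots> \<le> C" using bound[OF t] by simp
    finally show "\<bar>R (Suc m - k + k) t\<bar> \<le> C" using k by simp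
  qed (use R W x in auto)
  then show ?thesis using uE by (simp add: R_def E_def)
qed

section \<open>Existence and uniqueness of the interpolation polynomial\<close>

text \<open>Newton's construction: a new node is served by adding a multiple of the polynomial that
  vanishes at all earlier nodes.\<close>

lemma interpolation_poly_exists:
  fixes s y :: "nat \<Rightarrow> 'a::field"
  assumes "inj_on s {..m}"
  shows "\<exists>p. degree p \<le> m \<and> (\<forall>j\<le>m. poly p (s j) = y j)"
  using assms
proof (induction m)
  case 0
  then show ?case by (intro exI[of _ "[:y 0:]"]) auto
next
  case (Suc m)
  then obtain p where p: "degree p \<le> m" "\<And>j. j \<le> m \<Longrightarrow> poly p (s j) = y j"
    using inj_on_subset[of s "{..Suc m}" "{..m}"] by auto
  define \<omega> where "\<omega> = (\<Prod>i\<le>m. [:- s i, 1:])"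
  have \<omega>_eq: "poly \<omega> t = (\<Prod>i\<le>m. t - s i)" for t
    by (simp add: \<omega>_def poly_prod)
  have "s (Suc m) \<noteq> s i" if "i \<le> m" for i
    using inj_onD[OF Suc.prems, of "Suc m" i] that by auto
  then have \<omega>m: "poly \<omega> (s (Suc m)) \<noteq> 0" by (auto simp: \<omega>_eq)
  have deg: "degree \<omega> = Suc m"
    by (simp add: \<omega>_def degree_prod_eq_sum_degree)
  define c where "c = (y (Suc m) - poly p (s (Suc m))) / poly \<omega> (s (Suc m))"
  show ?case
  proof (intro exI conjI allI impI)
    show "degree (p + smult c \<omega>) \<le> Suc m"
      using p(1) deg by (intro degree_add_le) auto
    show "poly (p + smult c \<omega>) (s j) = y j" if "j \<le> Suc m" for j
    proof (cases "j = Suc m")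
      case True
      then show ?thesis using \<omega>m by (simp add: c_def)
    next
      case False
      then have "j \<le> m" using that by simp
      then show ?thesis using p(2) by (auto simp: \<omega>_eq)
    qed
  qed
qed

text \<open>\<open>interp_poly\<close> is a definite description, so its properties need existence
  and uniqueness. Two candidates of degree at most m agree at m + 1 points and hence
  coincide.\<close>

lemma interp_poly:
  assumes "inj_on s {..m}"
  shows "degree (interp_poly m s F) \<le> m"
    and "\<And>j. j \<le> m \<Longrightarrow> poly (interp_poly m s F) (of_real (s j)) = F (s j)"
proof -
  let ?P = "\<lambda>p. degree p \<le> m \<and> (\<forall>j\<le>m. poly p (complex_of_real (s j)) = F (s j))"
  have inj: "inj_on (\<lambda>j. complex_of_real (s j)) {..m}"
    using assms by (auto simp: inj_on_def)
  obtain p where p: "?P p"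
    using interpolation_poly_exists[OF inj, of "\<lambda>j. F (s j)"] by auto
  have "q = p" if "?P q" for q
    by (rule poly_eqI_degree[of "(\<lambda>j. complex_of_real (s j)) ` {..m}"])
      (use p that in \<open>auto simp: card_image[OF inj]\<close>)
  then have "?P (interp_poly m s F)"
    unfolding interp_poly_def using p by (rule_tac theI) auto
  then show "degree (interp_poly m s F) \<le> m"
    and "\<And>j. j \<le> m \<Longrightarrow> poly (interp_poly m s F) (of_real (s j)) = F (s j)"
    by auto
qed


section \<open>Quadrature error on one panel\<close>

text \<open>Both endpoints are nodes, so the boundary terms of order 1/\<kappa> vanish. With
  \<open>h = B - A\<close> and up to the factor 1/\<kappa>^2, the two boundary values of
  \<open>E 1\<close> contribute at most \<open>C * h ^ m / fact m\<close> each, and the integral of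
  \<open>E 2\<close> at most \<open>h * C * h ^ (m - 1) / fact (m - 1)\<close>, which is m times as
  much; hence the factor m + 2.\<close>

lemma filon_panel_error:
  fixes D :: "nat \<Rightarrow> real \<Rightarrow> complex" and p :: "complex poly"
  assumes AB: "A < B" and m: "m \<ge> 1" and \<kappa>: "\<kappa> > 0"
    and D: "\<And>k x. k \<le> m \<Longrightarrow> x \<in> {A..B} \<Longrightarrow>
      (D k has_vector_derivative D (Suc k) x) (at x within {A..B})"
    and bound: "\<And>x. x \<in> {A..B} \<Longrightarrow> cmod (D (Suc m) x) \<le> C"
    and p: "degree p \<le> m"
    and Z: "finite Z" "Z \<subseteq> {A..B}" "card Z = Suc m" "A \<in> Z" "B \<in> Z"
      "\<And>z. z \<in> Z \<Longrightarrow> poly p (of_real z) = D 0 z"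
  shows "cmod (integral {A..B} (\<lambda>x. D 0 x * exp (\<i> * complex_of_real (\<kappa> * x)))
             - integral {A..B} (\<lambda>x. poly p (of_real x) * exp (\<i> * complex_of_real (\<kappa> * x))))
           \<le> (real m + 2) / (fact m * \<kappa>\<^sup>2) * C * (B - A) ^ m"
proof -
  define e where "e = (\<lambda>x. exp (\<i> * complex_of_real (\<kappa> * x)))"
  define E where "E j t = D j t - poly ((pderiv ^^ j) p) (of_real t)" for j t
  have norm_e: "cmod (e x) = 1" for x by (simp add: e_def)
  have E: "(E j has_vector_derivative E (Suc j) t) (at t within {A..B})"
    if "j \<le> m" "t \<in> {A..B}" for j t
  proof -
    from has_vector_derivative_diff[OF D[OF that] higher_pderiv_has_vector_derivative] show ?thesis
      unfolding E_def .
  qed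
  have E_bound: "cmod (E j x) \<le> C * (B - A) ^ (Suc m - j) / fact (Suc m - j)"
    if "j \<le> Suc m" "x \<in> {A..B}" for j x
    unfolding E_def
    by (rule interpolation_error_derivative[where Z = Z]) (use D bound p Z that in auto)
  have E0: "E 0 A = 0" "E 0 B = 0" using Z by (auto simp: E_def)
  have e: "(e has_vector_derivative \<i> * \<kappa> * e t) (at t within S)" for t S
  proof -
    have "((\<lambda>z. exp (\<i> * (of_real \<kappa> * z))) has_field_derivative
            \<i> * \<kappa> * exp (\<i> * (of_real \<kappa> * of_real t))) (at (of_real t))"
      by (auto intro!: derivative_eq_intros)
    from has_vector_derivative_real_field[OF this] show ?thesis by (simp add: e_def)
  qed
  \<comment> \<open>Up to the remainder \<open>E 2 x * e x / \<kappa>\<^sup>2\<close>, the antiderivative of \<open>E 0 x * e x\<close> given by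
    integrating by parts twice.\<close>
  define G where "G x = (E 0 x / (\<i> * \<kappa>) + E 1 x / \<kappa>\<^sup>2) * e x" for x
  have G: "(G has_vector_derivative E 0 x * e x + E 2 x * e x / \<kappa>\<^sup>2) (at x within {A..B})"
    if x: "x \<in> {A..B}" for x
  proof -
    have E01: "(E 0 has_vector_derivative E 1 x) (at x within {A..B})"
      "(E 1 has_vector_derivative E 2 x) (at x within {A..B})"
      using E[of 0 x] E[of 1 x] m x by (auto simp: numeral_2_eq_2)
    have "(G has_vector_derivative
        (E 0 x / (\<i> * \<kappa>) + E 1 x / \<kappa>\<^sup>2) * (\<i> * \<kappa> * e x) + (E 1 x / (\<i> * \<kappa>) + E 2 x / \<kappa>\<^sup>2) * e x)
        (at x within {A..B})"
      unfolding G_def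
      by (intro has_vector_derivative_mult has_vector_derivative_add has_vector_derivative_divide E01 e)
    \<comment> \<open>The two \<open>E 1\<close> terms cancel because
      \<open>1 / (\<i> * \<kappa>) = - \<i> / \<kappa>\<close>.\<close>
    also have "(E 0 x / (\<i> * \<kappa>) + E 1 x / \<kappa>\<^sup>2) * (\<i> * \<kappa> * e x) + (E 1 x / (\<i> * \<kappa>) + E 2 x / \<kappa>\<^sup>2) * e x
        = E 0 x * e x + E 2 x * e x / \<kappa>\<^sup>2"
      using \<kappa> by (simp add: field_simps power2_eq_square)
    finally show ?thesis .
  qed
  have "continuous_on {A..B} (D 0)"
    by (rule continuous_on_vector_derivative[OF D]) auto
  then have int1: "(\<lambda>x. D 0 x * e x) integrable_on {A..B}"
    unfolding e_def by (intro integrable_continuous_real continuous_intros)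
  have int2: "(\<lambda>x. poly p (of_real x) * e x) integrable_on {A..B}"
    unfolding e_def by (intro integrable_continuous_real continuous_intros)
  define I where "I = integral {A..B} (\<lambda>x. D 0 x * e x) - integral {A..B} (\<lambda>x. poly p (of_real x) * e x)"
  have I: "((\<lambda>x. E 0 x * e x) has_integral I) {A..B}"
    using has_integral_diff[OF int1[THEN integrable_integral] int2[THEN integrable_integral]]
    by (simp add: E_def I_def algebra_simps)
  have "((\<lambda>x. E 0 x * e x + E 2 x * e x / \<kappa>\<^sup>2) has_integral G B - G A) {A..B}"
    using AB G by (intro fundamental_theorem_of_calculus) auto
  \<comment> \<open>Subtracting the quadrature error \<open>I\<close> isolates the integral of the
    \<open>E 2\<close> term, so \<open>I\<close> is controlled by \<open>G\<close> at the endpoints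
    and by this remainder.\<close>
  from has_integral_diff[OF this I]
  have rest: "((\<lambda>x. E 2 x * e x / \<kappa>\<^sup>2) has_integral G B - G A - I) (cbox A B)"
    by simp
  define h where "h = B - A"
  have h: "h > 0" using AB by (simp add: h_def)
  have C: "0 \<le> C" using bound[of A] AB by (intro order_trans[OF norm_ge_zero]) auto
  \<comment> \<open>This turns the exponent \<open>Suc m - 2\<close> into \<open>q\<close>; the
    length of the interval then supplies the missing factor \<open>h\<close>.\<close>
  obtain q where q: "m = Suc q" using m by (cases m) auto
  have "cmod (G B - G A - I) \<le> (C * h ^ q / fact q / \<kappa>\<^sup>2) * measure lborel (cbox A B)"
  proof (rule has_integral_bound[OF _ rest])
    fix x assume "x \<in> cbox A B"
    then show "cmod (E 2 x * e x / \<kappa>\<^sup>2) \<le> C * h ^ q / fact q / \<kappa>\<^sup>2"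
      using divide_right_mono[OF E_bound[of 2 x], of "\<kappa>\<^sup>2"] q
      by (simp add: norm_mult norm_divide norm_power norm_e h_def)
  qed (use C h in auto)
  then have 1: "cmod (G B - G A - I) \<le> C * h ^ m / fact q / \<kappa>\<^sup>2"
    using AB by (simp add: h_def q mult.commute mult.left_commute)
  have 2: "cmod (G x) \<le> C * h ^ m / fact m / \<kappa>\<^sup>2" if "x = A \<or> x = B" for x
  proof -
    have "x \<in> {A..B}" "E 0 x = 0" using that AB E0 by auto
    then show ?thesis using divide_right_mono[OF E_bound[of 1 x], of "\<kappa>\<^sup>2"]
      by (simp add: G_def norm_mult norm_divide norm_power norm_e h_def)
  qed
  have "cmod I \<le> cmod (G B) + cmod (G A) + cmod (G B - G A - I)"
    by norm
  also have "\<dots> \<le> C * h ^ m / fact m / \<kappa>\<^sup>2 + C * h ^ m / fact m / \<kappa>\<^sup>2 + C * h ^ m / fact q / \<kappa>\<^sup>2"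
    using 1 2 by (intro add_mono) auto
  also have "C * h ^ m / fact q / \<kappa>\<^sup>2 = real m * (C * h ^ m / fact m / \<kappa>\<^sup>2)"
    unfolding q fact_Suc by (simp add: field_simps del: of_nat_Suc)
  also have "C * h ^ m / fact m / \<kappa>\<^sup>2 + C * h ^ m / fact m / \<kappa>\<^sup>2 + real m * (C * h ^ m / fact m / \<kappa>\<^sup>2)
      = (real m + 2) / (fact m * \<kappa>\<^sup>2) * C * (B - A) ^ m"
    by (simp add: h_def algebra_simps add_divide_distrib)
  finally show ?thesis unfolding I_def e_def .
qed


section \<open>Derivatives within closed intervals, and monotonicity of g and its derivative\<close>

lemma C_on_has_vector_derivative:
  assumes "C_on r S F" "k < r" "x \<in> S"
  shows "(deriv_within S k F has_vector_derivative deriv_within S (Suc k) F x) (at x within S)"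
  using assms by (auto simp: C_on_def vector_derivative_works)

text \<open>Continuity on a compact interval gives boundedness, which makes \<open>SUP\<close> a
  genuine upper bound.\<close>

lemma deriv_within_bound:
  assumes "C_on r {a..b} F" "x \<in> {a..b}"
  shows "norm (deriv_within {a..b} r F x) \<le> sup_norm_on {a..b} (deriv_within {a..b} r F)"
proof -
  have "continuous_on {a..b} (\<lambda>x. norm (deriv_within {a..b} r F x))"
    using assms(1) by (auto simp: C_on_def intro: continuous_on_norm)
  then have "compact ((\<lambda>x. norm (deriv_within {a..b} r F x)) ` {a..b})"
    by (rule compact_continuous_image) simp
  then have "bdd_above ((\<lambda>x. norm (deriv_within {a..b} r F x)) ` {a..b})"
    by (intro bounded_imp_bdd_above compact_imp_bounded)
  then show ?thesis
    unfolding sup_norm_on_def using assms(2) by (intro cSUP_upper)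
qed

lemma C_on_lower:
  assumes "C_on r S F" "k < r"
  shows "C_on k S F"
  using assms unfolding C_on_def
  by (auto simp: continuous_on_eq_continuous_within intro: differentiable_imp_continuous_within)

lemma C_on_has_real_derivative:
  fixes F :: "real \<Rightarrow> real"
  assumes "C_on r S F" "k < r" "x \<in> S"
  shows "(deriv_within S k F has_real_derivative deriv_within S (Suc k) F x) (at x within S)"
  using C_on_has_vector_derivative[OF assms]
  by (simp add: has_real_derivative_iff_has_vector_derivative)

text \<open>Monotonicity gives a nonnegative derivative in the interior, continuity carries this to
  the endpoints, and nonvanishing makes it strict.\<close>

lemma mono_on_deriv_within_pos:
  assumes g: "C_on 2 {0..1} g" "mono_on {0..1} g"
    and nz: "\<And>x. x \<in> {0..1} \<Longrightarrow> deriv_within {0..1} 1 g x \<noteq> 0"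
    and x: "x \<in> {0..1}"
  shows "deriv_within {0..1} 1 g x > (0::real)"
proof -
  have "continuous_on {0..1} (deriv_within {0..1} 1 g)"
    using C_on_lower[OF g(1), of 1] by (auto simp: C_on_def)
  moreover have "0 \<le> deriv_within {0..1} 1 g t" if t: "t \<in> {0<..<1}" for t
  proof (rule mono_on_imp_deriv_nonneg[OF g(2)])
    show "(g has_real_derivative deriv_within {0..1} 1 g t) (at t)"
      using C_on_has_real_derivative[OF g(1), of 0 t] t at_within_Icc_at[of 0 t 1] by simp
    show "t \<in> interior {0..1}" using t by simp
  qed
  ultimately have "0 \<le> deriv_within {0..1} 1 g x"
    using x continuous_ge_on_closure[of "{0<..<1}" "deriv_within {0..1} 1 g" x 0]
    by auto
  then show ?thesis using nz[OF x] by linarith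
qed

lemma deriv_within_mvt:
  fixes g :: "real \<Rightarrow> real"
  assumes g: "C_on 2 {0..1} g" and ab: "0 \<le> a" "a < b" "b \<le> 1"
  shows "\<exists>x\<in>{a<..<b}. g b - g a = deriv_within {0..1} 1 g x * (b - a)"
proof (rule mvt_simple[OF ab(2)])
  fix x assume "a \<le> x" "x \<le> b"
  then show "(g has_derivative (*) (deriv_within {0..1} 1 g x)) (at x within {a..b})"
    using C_on_has_real_derivative[OF g, of 0 x] ab
    by (auto simp: has_field_derivative_def intro: has_derivative_subset)
qed

lemma strict_mono_on_deriv_within_pos:
  assumes g: "C_on 2 {0..1} g"
    and pos: "\<And>x. x \<in> {0..1} \<Longrightarrow> deriv_within {0..1} 1 g x > (0::real)"
  shows "strict_mono_on {0..1} g"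
proof (rule strict_mono_onI)
  fix a b :: real assume ab: "a \<in> {0..1}" "b \<in> {0..1}" "a < b"
  obtain x where x: "x \<in> {a<..<b}" "g b - g a = deriv_within {0..1} 1 g x * (b - a)"
    using deriv_within_mvt[OF g, of a b] ab by auto
  have "0 < deriv_within {0..1} 1 g x" using pos x ab by auto
  then have "0 < g b - g a" using x(2) ab(3) by simp
  then show "g a < g b" by simp
qed

text \<open>By Rolle's theorem a nonvanishing second derivative makes the first one injective. A
  continuous injective function on an interval takes inner values strictly between its endpoint
  values. Hence slopes at the partition points control the slope in between.\<close>

lemma deriv_within_le_endpoints:
  fixes g :: "real \<Rightarrow> real"
  assumes g: "C_on 2 {0..1} g"
    and nz: "\<And>x. x \<in> {0<..<1} \<Longrightarrow> deriv_within {0..1} 2 g x \<noteq> 0"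
    and ab: "0 \<le> a" "b \<le> 1" and x: "x \<in> {a..b}"
  shows "deriv_within {0..1} 1 g x \<le> max (deriv_within {0..1} 1 g a) (deriv_within {0..1} 1 g b)"
proof -
  let ?d = "deriv_within {0..1} 1 g"
  have cont: "continuous_on {0..1} ?d"
    using C_on_lower[OF g(1), of 1] by (auto simp: C_on_def)
  have "?d s \<noteq> ?d t" if st: "s \<in> {0..1}" "t \<in> {0..1}" "s < t" for s t
  proof
    assume "?d s = ?d t"
    then have "\<exists>z>s. z < t \<and> (\<lambda>v. deriv_within {0..1} 2 g z * v) = (\<lambda>v. 0)"
    proof (intro Rolle_deriv[OF st(3)])
      show "continuous_on {s..t} ?d" using continuous_on_subset[OF cont] st by auto
      fix z assume z: "s < z" "z < t"
      then have "(?d has_real_derivative deriv_within {0..1} 2 g z) (at z)"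
        using C_on_has_real_derivative[OF g, of 1 z] at_within_Icc_at[of 0 z 1] st
        by (simp add: numeral_2_eq_2)
      then show "(?d has_derivative (\<lambda>v. deriv_within {0..1} 2 g z * v)) (at z)"
        by (simp add: has_field_derivative_def)
    qed
    then obtain z where "z > s" "z < t" "deriv_within {0..1} 2 g z = 0"
      by (metis mult.right_neutral)
    then show False using nz[of z] st by auto
  qed
  then have inj: "inj_on ?d {0..1}" by (rule linorder_inj_onI) auto
  show ?thesis
  proof (cases "x = a \<or> x = b")
    case False
    then have "a < x" "x < b" using x by auto
    moreover have sub: "{a..b} \<subseteq> {0..1}" using ab by auto
    ultimately show ?thesis
      using continuous_inj_imp_mono[of a x b ?d] continuous_on_subset[OF cont sub]
        inj_on_subset[OF inj sub] by fastforce
  qed auto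
qed

section \<open>Change of variables\<close>

text \<open>With \<open>H\<close> a primitive of the transformed integrand, the chain rule shows
  that \<open>H \<circ> g\<close> is a primitive of the original one, and the fundamental theorem of
  calculus compares the two integrals.\<close>

lemma osc_integral_substitution:
  assumes g: "C_on 2 {0..1} g" "strict_mono_on {0..1} g"
    and nz: "\<And>x. x \<in> {0..1} \<Longrightarrow> deriv_within {0..1} 1 g x \<noteq> 0"
    and cont: "continuous_on {g 0..g 1} (Psi f g)"
  shows "osc_integral \<kappa> f g
    = integral {g 0..g 1} (\<lambda>x. Psi f g x * exp (\<i> * complex_of_real (\<kappa> * x)))"
proof -
  let ?F = "\<lambda>x. Psi f g x * exp (\<i> * complex_of_real (\<kappa> * x))"
  define H where "H u = integral {g 0..u} ?F" for u
  have mono: "mono_on {0..1} g" using g(2) by (rule strict_mono_on_imp_mono_on)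
  have range: "g ` {0..1} \<subseteq> {g 0..g 1}"
    using mono_onD[OF mono, of 0] mono_onD[OF mono, of _ 1] by auto
  have "((\<lambda>x. f x * exp (\<i> * complex_of_real (\<kappa> * g x))) has_integral (H \<circ> g) 1 - (H \<circ> g) 0) {0..1}"
  proof (rule fundamental_theorem_of_calculus)
    fix x :: real assume x: "x \<in> {0..1}"
    have "(g has_vector_derivative deriv_within {0..1} 1 g x) (at x within {0..1})"
      using C_on_has_vector_derivative[OF g(1), of 0 x] x by simp
    moreover have "(H has_vector_derivative ?F (g x)) (at (g x) within g ` {0..1})"
    proof (rule has_vector_derivative_within_subset[OF _ range])
      show "(H has_vector_derivative ?F (g x)) (at (g x) within {g 0..g 1})"
        unfolding H_def
        by (intro integral_has_vector_derivative continuous_intros cont)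
          (use x range in blast)
    qed
    ultimately have "(H \<circ> g has_vector_derivative deriv_within {0..1} 1 g x *\<^sub>R ?F (g x)) (at x within {0..1})"
      by (rule vector_diff_chain_within)
    \<comment> \<open>Injectivity of \<open>g\<close> reduces \<open>inv_into {0..1} g (g x)\<close>
      to \<open>x\<close>, and the chain rule factor cancels the denominator in
      \<open>Psi\<close>.\<close>
    also have "deriv_within {0..1} 1 g x *\<^sub>R ?F (g x) = f x * exp (\<i> * complex_of_real (\<kappa> * g x))"
      using nz[OF x] x strict_mono_on_imp_inj_on[OF g(2)]
      by (simp add: Psi_def scaleR_conv_of_real del: deriv_within.simps)
    finally show "(H \<circ> g has_vector_derivative f x * exp (\<i> * complex_of_real (\<kappa> * g x))) (at x within {0..1})" .
  qed simp
  then show ?thesis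
    by (simp add: osc_integral_def H_def integral_unique)
qed

section \<open>Adding errors and counting points over adjacent pieces\<close>

text \<open>Here \<open>h\<close> is a running exact integral, \<open>q\<close> the local rule and
  \<open>c\<close> a potential whose increments bound the local errors. It serves both for panels in
  a subinterval and for subintervals in the unit interval.\<close>

lemma telescoping_error:
  fixes h :: "nat \<Rightarrow> 'a::real_normed_vector"
  assumes "\<And>i. i \<in> {1..N} \<Longrightarrow> norm (h i - h (i - 1) - q i) \<le> c i - c (i - 1)"
  shows "norm (h N - h 0 - (\<Sum>i=1..N. q i)) \<le> c N - c 0"
  using assms
proof (induction N)
  case (Suc N)
  have "norm (h N - h 0 - (\<Sum>i=1..N. q i)) \<le> c N - c 0"
    using Suc.prems by (intro Suc.IH) auto
  moreover have "norm (h (Suc N) - h N - q (Suc N)) \<le> c (Suc N) - c N"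
    using Suc.prems[of "Suc N"] by simp
  moreover have eq: "h (Suc N) - h 0 - (\<Sum>i=1..Suc N. q i)
      = (h N - h 0 - (\<Sum>i=1..N. q i)) + (h (Suc N) - h N - q (Suc N))"
    by simp
  ultimately show ?case
    unfolding eq
    using norm_triangle_ineq[of "h N - h 0 - (\<Sum>i=1..N. q i)" "h (Suc N) - h N - q (Suc N)"]
    by linarith
qed simp

text \<open>The point \<open>c (i - 1)\<close> shared with the preceding piece is already present
  there, so piece \<open>i\<close> adds at most \<open>w i\<close> points. Excluding
  \<open>c 0\<close> from the union gives the result the shape of its own hypothesis, so that it can
  be used on two levels.\<close>

lemma card_chain:
  fixes N :: nat
  assumes "\<And>i. i \<in> {1..N} \<Longrightarrow> finite (P i) \<and> c i \<in> P i \<and> card (P i - {c (i - 1)}) \<le> w i"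
  shows "card ((\<Union>i\<in>{1..N}. P i) - {c 0}) \<le> (\<Sum>i=1..N. w i)"
  using assms
proof (induction N)
  case (Suc N)
  let ?U = "\<Union>i\<in>{1..N}. P i"
  have "(\<Union>i\<in>{1..Suc N}. P i) - {c 0} \<subseteq> (?U - {c 0}) \<union> (P (Suc N) - {c N})"
  proof -
    \<comment> \<open>For \<open>N = 0\<close> there is no preceding piece, and the shared point is
      \<open>c 0\<close> itself.\<close>
    have "c N \<in> insert (c 0) ?U"
      using Suc.prems[of N] by (cases "N = 0") auto
    then show ?thesis by (auto simp: atLeastAtMostSuc_conv)
  qed
  then have "card ((\<Union>i\<in>{1..Suc N}. P i) - {c 0}) \<le> card ((?U - {c 0}) \<union> (P (Suc N) - {c N}))"
    using Suc.prems by (intro card_mono) auto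
  also have "\<dots> \<le> card (?U - {c 0}) + card (P (Suc N) - {c N})"
    by (rule card_Un_le)
  also have "\<dots> \<le> (\<Sum>i=1..N. w i) + w (Suc N)"
    using Suc.prems[of "Suc N"] Suc.IH Suc.prems by (intro add_mono) auto
  finally show ?case by simp
qed simp

section \<open>The graded partition and the order of the nodes\<close>

lemma graded_pt_less:
  assumes "\<kappa> > 1" "n > 1" "i < j"
  shows "graded_pt \<kappa> n i < graded_pt \<kappa> n j"
  using assms by (auto simp: graded_pt_def divide_strict_right_mono)

lemma graded_pt_range:
  assumes "\<kappa> > 1" "n > 1" "j \<le> n"
  shows "graded_pt \<kappa> n j \<in> {0..1}"
proof -
  have "graded_pt \<kappa> n n = 1" using assms by (simp add: graded_pt_def)
  then show ?thesis
    using graded_pt_less[OF assms(1,2), of j n] assms(3)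
    by (cases "j = n") (auto simp: graded_pt_def)
qed

text \<open>The first subinterval has length 1/\<kappa>. From then on neighbouring points have the
  constant ratio \<delta>, so the step is \<open>1 - \<delta>\<close> times a point that is at most
  1.\<close>

lemma graded_pt_step:
  assumes "\<kappa> > 1" "n > 1" "j \<in> {1..n}"
  shows "graded_pt \<kappa> n j - graded_pt \<kappa> n (j - 1) \<le> max (1 / \<kappa>) (1 - \<kappa> powr (- 1 / (real n - 1)))"
proof (cases "j = 1")
  case True
  then show ?thesis using assms by (simp add: graded_pt_def powr_minus_divide)
next
  case False
  define \<delta> where "\<delta> = \<kappa> powr (- 1 / (real n - 1))"
  have "\<delta> \<le> \<kappa> powr 0" unfolding \<delta>_def using assms by (intro powr_mono) auto
  then have \<delta>: "\<delta> \<le> 1" using assms by simp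
  have "(real (j - 1) - 1) / (real n - 1) - 1
      = ((real j - 1) / (real n - 1) - 1) + - 1 / (real n - 1)"
    using False assms by (simp add: of_nat_diff diff_divide_distrib add_divide_distrib)
  moreover have "graded_pt \<kappa> n (j - 1) = \<kappa> powr ((real (j - 1) - 1) / (real n - 1) - 1)"
    "graded_pt \<kappa> n j = \<kappa> powr ((real j - 1) / (real n - 1) - 1)"
    using False assms by (auto simp: graded_pt_def)
  ultimately have "graded_pt \<kappa> n (j - 1) = graded_pt \<kappa> n j * \<delta>"
    by (simp only: \<delta>_def powr_add)
  then have "graded_pt \<kappa> n j - graded_pt \<kappa> n (j - 1) = graded_pt \<kappa> n j * (1 - \<delta>)"
    by (simp add: algebra_simps)
  also have "\<dots> \<le> 1 * (1 - \<delta>)"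
    using graded_pt_range[of \<kappa> n j] assms \<delta> by (intro mult_right_mono) auto
  finally show ?thesis by (simp add: \<delta>_def)
qed

lemma valid_nodes_less:
  assumes T: "valid_nodes m T" and ab: "0 \<le> a" "a < b" "b \<le> 1" and ij: "i < j" "j \<le> m"
  shows "T a b i < T a b j"
  using ij(1) ij(2)
proof (induction j)
  case 0
  then show ?case by simp
next
  case (Suc j)
  have "T a b j < T a b (Suc j)" using T ab Suc.prems by (auto simp: valid_nodes_def)
  then show ?case using Suc by (cases "i = j") auto
qed

section \<open>The composite rule: error bound and number of evaluations\<close>

theorem proposition3p1:
  fixes f :: "real \<Rightarrow> complex" and g :: "real \<Rightarrow> real"
    and \<kappa> \<sigma> \<eta> :: real and n m :: nat
    and T :: "real \<Rightarrow> real \<Rightarrow> nat \<Rightarrow> real"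
  assumes "C_on 2 {0..1} f" and "C_on 2 {0..1} g"
    and "mono_on {0..1} g"
    and "\<And>x. x \<in> {0..1} \<Longrightarrow> deriv_within {0..1} 1 g x \<noteq> 0"
    and "\<And>x. x \<in> {0<..<1} \<Longrightarrow> deriv_within {0..1} 2 g x \<noteq> 0"
    and "\<sigma> = sup_norm_on {0..1} (deriv_within {0..1} 1 g)"
    and "\<kappa> > 1" and "n > 1"
    and "\<eta> = max (1 / \<kappa>) (1 - \<kappa> powr (- 1 / (real n - 1)))"
    and "m \<ge> 1"
    and "C_on (m + 1) {g 0..g 1} (Psi f g)"
    and "valid_nodes m T"
  shows "cmod (osc_integral \<kappa> f g - filon_composite T \<kappa> n m f g)
           \<le> 3 * (real m + 1) / (fact m * \<kappa>\<^sup>2)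
              * sup_norm_on {g 0..g 1} (deriv_within {g 0..g 1} (m + 1) (Psi f g))
              * \<sigma> * \<eta> ^ (m - 1)
         \<and> int (num_evals T \<kappa> n m g) \<le> \<lceil>\<sigma>\<rceil> * int n * int m + 1"
proof -
  note g = assms(2)
  let ?d = "deriv_within {0..1} 1 g"
  let ?S = "{g 0..g 1}"
  define D where "D k = deriv_within ?S k (Psi f g)" for k
  define C where "C = sup_norm_on ?S (D (m + 1))"
  define x where "x = graded_pt \<kappa> n"
  define N where "N = subdiv \<kappa> n g"
  define y where "y j = uniform_pt (N j) (x (j - 1)) (x j)" for j

  have pos: "?d t > 0" if "t \<in> {0..1}" for t
    using mono_on_deriv_within_pos[OF g assms(3,4) that] by simp
  have sm: "strict_mono_on {0..1} g"
    using strict_mono_on_deriv_within_pos[OF g pos] .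
  have g_less: "g s < g t" if "0 \<le> s" "s < t" "t \<le> 1" for s t
    using strict_mono_onD[OF sm, of s t] that by auto
  have g_le: "g s \<le> g t" if "0 \<le> s" "s \<le> t" "t \<le> 1" for s t
    using g_less[of s t] that by (cases "s = t") auto
  have D: "(D k has_vector_derivative D (Suc k) t) (at t within ?S)"
    if "k \<le> m" "t \<in> ?S" for k t
    unfolding D_def using C_on_has_vector_derivative[OF assms(11), of k t] that by simp
  have D_bound: "cmod (D (Suc m) t) \<le> C" if "t \<in> ?S" for t
    using deriv_within_bound[OF assms(11) that] by (simp add: C_def D_def del: deriv_within.simps)
  have C0: "0 \<le> C" 
    using D_bound[of "g 0"] g_le[of 0 1] by (intro order_trans[OF norm_ge_zero]) auto
  have D_0: "D 0 = Psi f g" by (simp add: D_def)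
  have contPsi: "continuous_on ?S (Psi f g)"
    using continuous_on_vector_derivative[of ?S "D 0" "D 1"] D[of 0] D_0 by auto

  have d_le: "?d t \<le> \<sigma>" if "t \<in> {0..1}" for t
    using deriv_within_bound[OF C_on_lower[OF g, of 1] that] assms(6) by simp
  have \<sigma>: "g 1 - g 0 \<le> \<sigma>"
    using deriv_within_mvt[OF g, of 0 1] d_le by force

  have x_less: "x i < x j" if "i < j" for i j
    unfolding x_def using graded_pt_less[OF assms(7,8) that] .
  have x_range: "0 \<le> x j" "x j \<le> 1" if "j \<le> n" for j
    using graded_pt_range[OF assms(7,8) that] by (auto simp: x_def)
  have x_range': "x j \<in> {0..1}" "x (j - 1) \<in> {0..1}" if "j \<in> {1..n}" for j
    using x_range[of j] x_range[of "j - 1"] that by auto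
  have x_ends: "x 0 = 0" "x n = 1" using assms(7,8) by (auto simp: x_def graded_pt_def)
  have x_step: "x j - x (j - 1) \<le> \<eta>" if "j \<in> {1..n}" for j
    unfolding x_def assms(9) using graded_pt_step[OF assms(7,8) that] .

  have N_eq: "N j = nat \<lceil>max (?d (x (j - 1))) (?d (x j))\<rceil>" if "j \<in> {1..n}" for j
    using pos[OF x_range'(1)[OF that]] pos[OF x_range'(2)[OF that]]
    by (simp add: N_def subdiv_def x_def[symmetric] del: deriv_within.simps)
  have N_ge: "max (?d (x (j - 1))) (?d (x j)) \<le> real (N j)" if "j \<in> {1..n}" for j
    unfolding N_eq[OF that] by (rule real_nat_ceiling_ge)
  \<comment> \<open>\<open>N j\<close> is a divisor in \<open>uniform_pt\<close>, and with
    \<open>N j = 0\<close> the rule on the subinterval would be an empty sum.\<close>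
  have N_pos: "N j > 0" if "j \<in> {1..n}" for j
    using N_ge[OF that] pos[OF x_range'(1)[OF that]] by (auto intro: gr0I)
  have N_le: "int (N j) \<le> \<lceil>\<sigma>\<rceil>" if "j \<in> {1..n}" for j
  proof -
    have "max (?d (x (j - 1))) (?d (x j)) \<le> \<sigma>"
      using d_le[OF x_range'(1)[OF that]] d_le[OF x_range'(2)[OF that]] by simp
    moreover have "0 \<le> \<sigma>" using d_le[of 0] pos[of 0] by simp
    ultimately show ?thesis unfolding N_eq[OF that] by (simp add: ceiling_mono)
  qed

  have y_step: "y j i - y j (i - 1) = (x j - x (j - 1)) / N j" if "i \<ge> 1" for i j
    using that by (simp add: y_def uniform_pt_def of_nat_diff diff_divide_distrib[symmetric] algebra_simps)
  have y_less: "y j (i - 1) < y j i" if "j \<in> {1..n}" "i \<in> {1..N j}" for i j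
  proof -
    have "0 < (x j - x (j - 1)) / N j"
      using x_less[of "j - 1" j] N_pos that by (intro divide_pos_pos) auto
    then show ?thesis using y_step[of i j] that(2) by simp
  qed
  have y_ends: "y j 0 = x (j - 1)" "y j (N j) = x j" if "j \<in> {1..n}" for j
    using N_pos[OF that] by (auto simp: y_def uniform_pt_def)
  have y_between: "x (j - 1) \<le> y j i" "y j i \<le> x j" if "j \<in> {1..n}" "i \<le> N j" for i j
  proof -
    have r: "0 \<le> real i / N j" "real i / N j \<le> 1" and w: "0 \<le> x j - x (j - 1)"
      using that x_less[of "j - 1" j] by (auto simp: divide_le_eq)
    have "y j i = x (j - 1) + (x j - x (j - 1)) * (real i / N j)"
      by (simp add: y_def uniform_pt_def)
    then show "x (j - 1) \<le> y j i" "y j i \<le> x j"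
      using mult_nonneg_nonneg[OF w r(1)] mult_left_mono[OF r(2) w] by auto
  qed
  have y_range: "0 \<le> y j i" "y j i \<le> 1" if "j \<in> {1..n}" "i \<le> N j" for i j
    using y_between[OF that] x_range'[OF that(1)] by auto

  show ?thesis
  proof
    define F where "F t = Psi f g t * exp (\<i> * complex_of_real (\<kappa> * t))" for t
    \<comment> \<open>Parametrising the primitive by the original variable makes the exact integral
      over a panel equal to \<open>H b - H a\<close>, as telescoping requires.\<close>
    define H where "H t = integral {g 0..g t} F" for t
    define K where "K = (real m + 2) / (fact m * \<kappa>\<^sup>2) * C"
    have K0: "0 \<le> K" using C0 by (simp add: K_def)
    have panel: "cmod (H b - H a - filon T \<kappa> m f g a b) \<le> K * (g b - g a) ^ m"
      if ab: "0 \<le> a" "a < b" "b \<le> 1" for a b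
    proof -
      define s where "s j = g (T a b j)" for j
      have T_ends: "T a b 0 = a" "T a b m = b" using assms(12) ab by (auto simp: valid_nodes_def)
      have T_range: "a \<le> T a b j" "T a b j \<le> b" if "j \<le> m" for j
      proof -
        show "a \<le> T a b j"
          using valid_nodes_less[OF assms(12) ab, of 0 j] T_ends that by (cases "j = 0") auto
        show "T a b j \<le> b"
          using valid_nodes_less[OF assms(12) ab, of j m] T_ends that by (cases "j = m") auto
      qed
      have inj: "inj_on s {..m}"
      proof (rule linorder_inj_onI)
        fix i j assume "i < j" "i \<in> {..m}" "j \<in> {..m}"
        then show "s i \<noteq> s j"
          using g_less[of "T a b i" "T a b j"] valid_nodes_less[OF assms(12) ab, of i j]
            T_range[of i] T_range[of j] ab by (auto simp: s_def)
      qed auto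
      have sub: "{g a..g b} \<subseteq> ?S" using g_le[of 0 a] g_le[of b 1] ab by auto
      have "cmod (integral {g a..g b} (\<lambda>x. D 0 x * exp (\<i> * complex_of_real (\<kappa> * x)))
             - integral {g a..g b} (\<lambda>x. poly (interp_poly m s (Psi f g)) (of_real x) * exp (\<i> * complex_of_real (\<kappa> * x))))
           \<le> (real m + 2) / (fact m * \<kappa>\<^sup>2) * C * (g b - g a) ^ m"
      proof (rule filon_panel_error[where Z = "s ` {..m}"])
        show "(D k has_vector_derivative D (Suc k) t) (at t within {g a..g b})"
          if "k \<le> m" "t \<in> {g a..g b}" for k t
          by (rule has_vector_derivative_within_subset[OF D sub]) (use that sub in blast)+
        show "cmod (D (Suc m) t) \<le> C" if "t \<in> {g a..g b}" for t
          using D_bound that sub by blast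
        show "s ` {..m} \<subseteq> {g a..g b}"
        proof
          fix z assume "z \<in> s ` {..m}"
          then obtain j where "j \<le> m" "z = g (T a b j)" by (auto simp: s_def)
          then show "z \<in> {g a..g b}"
            using g_le[of a "T a b j"] g_le[of "T a b j" b] T_range[of j] ab by auto
        qed
        show "g a \<in> s ` {..m}" "g b \<in> s ` {..m}"
          using T_ends by (auto simp: s_def intro: rev_image_eqI)
        show "poly (interp_poly m s (Psi f g)) (of_real z) = D 0 z" if "z \<in> s ` {..m}" for z
          using interp_poly(2)[OF inj] that by (auto simp: D_0)
        show "g a < g b" using g_less[OF ab] .
        show "card (s ` {..m}) = Suc m" using card_image[OF inj] by simp
        show "degree (interp_poly m s (Psi f g)) \<le> m" using interp_poly(1)[OF inj] .
      qed (use assms(7,10) in auto)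
      moreover have "H b - H a = integral {g a..g b} F"
      proof -
        have "F integrable_on {g 0..g b}"
          unfolding F_def using g_le[of b 1] ab
          by (intro integrable_continuous_real continuous_intros continuous_on_subset[OF contPsi]) auto
        then have "integral {g 0..g a} F + integral {g a..g b} F = integral {g 0..g b} F"
          using g_le[of 0 a] g_le[of a b] ab
          by (intro Henstock_Kurzweil_Integration.integral_combine) auto
        then show ?thesis by (simp add: H_def algebra_simps)
      qed
      ultimately show ?thesis
        by (simp add: filon_def F_def[abs_def] s_def[abs_def] K_def D_0)
    qed
    \<comment> \<open>The panel bound \<open>K * h ^ m\<close> is not additive in h. Trading m - 1
      factors for \<eta> leaves an increment of \<open>K * \<eta> ^ (m - 1) * g\<close>, and such
      increments telescope on both levels.\<close>
    have "cmod (H 1 - H 0 - filon_composite T \<kappa> n m f g) \<le> K * \<eta> ^ (m - 1) * g 1 - K * \<eta> ^ (m - 1) * g 0"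
      unfolding filon_composite_def x_def[symmetric] N_def[symmetric] x_ends[symmetric]
    proof (rule telescoping_error[where h = "\<lambda>j. H (x j)" and c = "\<lambda>j. K * \<eta> ^ (m - 1) * g (x j)"])
      fix j assume j: "j \<in> {1..n}"
      show "cmod (H (x j) - H (x (j - 1)) - filon_uniform T (N j) \<kappa> m f g (x (j - 1)) (x j))
              \<le> K * \<eta> ^ (m - 1) * g (x j) - K * \<eta> ^ (m - 1) * g (x (j - 1))"
        unfolding filon_uniform_def y_def[symmetric]
        unfolding y_ends[OF j, symmetric]
      proof (rule telescoping_error[where h = "\<lambda>i. H (y j i)" and c = "\<lambda>i. K * \<eta> ^ (m - 1) * g (y j i)"])
        fix i assume i: "i \<in> {1..N j}"
        let ?\<Delta> = "g (y j i) - g (y j (i - 1))"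
        have ab: "0 \<le> y j (i - 1)" "y j (i - 1) < y j i" "y j i \<le> 1"
          using y_range[OF j] y_less[OF j i] i by auto
        have \<Delta>0: "0 \<le> ?\<Delta>" using g_less[OF ab] by simp
        obtain t where t: "t \<in> {y j (i - 1)<..<y j i}" "?\<Delta> = ?d t * (y j i - y j (i - 1))"
          using deriv_within_mvt[OF g ab] by blast
        have "i \<le> N j" "i - 1 \<le> N j" using i by auto
        then have "t \<in> {x (j - 1)..x j}"
          using t(1) y_between(2)[OF j, of i] y_between(1)[OF j, of "i - 1"] by auto
        then have "?d t \<le> max (?d (x (j - 1))) (?d (x j))"
          using deriv_within_le_endpoints[OF g assms(5)] x_range'[OF j] by simp
        also have "\<dots> \<le> N j" using N_ge[OF j] .
        \<comment> \<open>This is what the choice of \<open>N j\<close> achieves: \<open>g\<close>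
          stretches a panel by at most \<open>N j\<close>, while the panel is one
          \<open>N j\<close>-th of its subinterval.\<close>
        finally have "?\<Delta> \<le> N j * ((x j - x (j - 1)) / N j)"
          unfolding t(2) using y_step[of i j] ab i by (intro mult_mono) auto
        also have "\<dots> = x j - x (j - 1)" using N_pos[OF j] by simp
        also have "\<dots> \<le> \<eta>" using x_step[OF j] .
        finally have "?\<Delta> ^ (m - 1) * ?\<Delta> \<le> \<eta> ^ (m - 1) * ?\<Delta>"
          using \<Delta>0 by (intro mult_right_mono power_mono)
        then have "K * ?\<Delta> ^ m \<le> K * (\<eta> ^ (m - 1) * ?\<Delta>)"
          using K0 power_minus_mult[of m ?\<Delta>] assms(10) by (intro mult_left_mono) auto
        with panel[OF ab]
        show "cmod (H (y j i) - H (y j (i - 1)) - filon T \<kappa> m f g (y j (i - 1)) (y j i))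
                \<le> K * \<eta> ^ (m - 1) * g (y j i) - K * \<eta> ^ (m - 1) * g (y j (i - 1))"
          by (simp add: algebra_simps)
      qed
    qed
    also have "\<dots> = K * \<eta> ^ (m - 1) * (g 1 - g 0)" by (simp add: algebra_simps)
    also have "\<dots> \<le> (3 * (real m + 1) / (fact m * \<kappa>\<^sup>2) * C * \<eta> ^ (m - 1)) * \<sigma>"
    proof -
      have "0 \<le> \<eta>" using assms(7,9) by (simp add: le_max_iff_disj)
      \<comment> \<open>The sharper factor m + 2 is relaxed to 3 (m + 1).\<close>
      moreover have "K \<le> 3 * (real m + 1) / (fact m * \<kappa>\<^sup>2) * C"
        unfolding K_def using C0 by (intro mult_right_mono divide_right_mono) auto
      ultimately show ?thesis
        using \<sigma> g_le[of 0 1] C0 by (intro mult_mono) auto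
    qed
    finally have "cmod (H 1 - H 0 - filon_composite T \<kappa> n m f g)
      \<le> (3 * (real m + 1) / (fact m * \<kappa>\<^sup>2) * C * \<eta> ^ (m - 1)) * \<sigma>" .
    moreover have "osc_integral \<kappa> f g = H 1 - H 0"
      using osc_integral_substitution[OF g sm assms(4) contPsi, of \<kappa>]
      by (simp add: H_def F_def[abs_def])
    ultimately show "cmod (osc_integral \<kappa> f g - filon_composite T \<kappa> n m f g)
           \<le> 3 * (real m + 1) / (fact m * \<kappa>\<^sup>2)
              * sup_norm_on ?S (deriv_within ?S (m + 1) (Psi f g)) * \<sigma> * \<eta> ^ (m - 1)"
      unfolding C_def D_def by (simp only: mult_ac)
  next
    \<comment> \<open>Each panel is charged only for its points other than the left end.\<close>
    define P where "P j i = filon_eval_pts T m g (y j (i - 1)) (y j i)" for j i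
    define Q where "Q j = filon_uniform_eval_pts T (N j) m g (x (j - 1)) (x j)" for j
    have Q_eq: "Q j = (\<Union>i\<in>{1..N j}. P j i)" for j
      by (simp add: Q_def P_def y_def filon_uniform_eval_pts_def)
    have P: "finite (P j i) \<and> g (y j i) \<in> P j i \<and> card (P j i - {g (y j (i - 1))}) \<le> m"
      if j: "j \<in> {1..n}" and i: "i \<in> {1..N j}" for j i
    proof (intro conjI)
      let ?t = "T (y j (i - 1)) (y j i)"
      have "?t 0 = y j (i - 1) \<and> ?t m = y j i"
        using assms(12) y_range[OF j] y_less[OF j i] i by (auto simp: valid_nodes_def)
      then have t: "?t 0 = y j (i - 1)" "?t m = y j i" by auto
      show "finite (P j i)" by (simp add: P_def filon_eval_pts_def)
      show "g (y j i) \<in> P j i" using t by (auto simp: P_def filon_eval_pts_def intro: rev_image_eqI)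
      \<comment> \<open>Removing the value at the left end rules out index 0, so only m indices
        remain.\<close>
      have "P j i - {g (y j (i - 1))} \<subseteq> (\<lambda>k. g (?t k)) ` {1..m}"
      proof
        fix z assume "z \<in> P j i - {g (y j (i - 1))}"
        then obtain k where k: "k \<le> m" "z = g (?t k)" "z \<noteq> g (?t 0)"
          using t by (auto simp: P_def filon_eval_pts_def)
        then have "k \<noteq> 0" by metis
        with k show "z \<in> (\<lambda>k. g (?t k)) ` {1..m}" by auto
      qed
      then have "card (P j i - {g (y j (i - 1))}) \<le> card ((\<lambda>k. g (?t k)) ` {1..m})"
        by (intro card_mono) auto
      also have "\<dots> \<le> m" using card_image_le[of "{1..m}" "\<lambda>k. g (?t k)"] by simp
      finally show "card (P j i - {g (y j (i - 1))}) \<le> m" .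
    qed
    have Q: "finite (Q j) \<and> g (x j) \<in> Q j \<and> card (Q j - {g (x (j - 1))}) \<le> N j * m"
      if j: "j \<in> {1..n}" for j
    proof (intro conjI)
      show "finite (Q j)" using P[OF j] by (auto simp: Q_eq)
      show "g (x j) \<in> Q j"
        using P[OF j, of "N j"] N_pos[OF j] y_ends[OF j] by (auto simp: Q_eq intro!: bexI[of _ "N j"])
      show "card (Q j - {g (x (j - 1))}) \<le> N j * m"
        using card_chain[of "N j" "P j" "\<lambda>i. g (y j i)" "\<lambda>_. m"] P[OF j] y_ends[OF j]
        by (simp add: Q_eq)
    qed
    let ?U = "\<Union>j\<in>{1..n}. Q j"
    have "num_evals T \<kappa> n m g = card ?U"
      by (simp add: num_evals_def filon_composite_eval_pts_def Q_def x_def N_def)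
    \<comment> \<open>Restoring the leftmost point accounts for the final + 1.\<close>
    also have "\<dots> \<le> card (?U - {g (x 0)}) + 1"
      using card_Diff1_le card.insert_remove[of "?U" "g (x 0)"] Q
      by (cases "g (x 0) \<in> ?U") (auto simp: card_Diff_singleton)
    also have "card (?U - {g (x 0)}) \<le> (\<Sum>j=1..n. N j * m)"
      using Q by (intro card_chain[where c = "\<lambda>j. g (x j)"]) auto
    finally have "int (num_evals T \<kappa> n m g) \<le> (\<Sum>j=1..n. int (N j) * int m) + 1"
      by (simp flip: of_nat_mult of_nat_sum)
    also have "(\<Sum>j=1..n. int (N j) * int m) \<le> (\<Sum>j=1..n. \<lceil>\<sigma>\<rceil> * int m)"
      using N_le by (intro sum_mono mult_right_mono) auto
    finally show "int (num_evals T \<kappa> n m g) \<le> \<lceil>\<sigma>\<rceil> * int n * int m + 1"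
      by (simp add: mult_ac)
  qed
qed

end
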